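(* Let $\mathbb{L}=(\mathcal{P},\mathcal{C},-)$ be a Laguerre plane, $p$ a point and $K$ a circle with $p\in K$. Let $\Delta=\Delta(p,K)$ be a group of automorphisms of $\mathbb{L}$ that maps the pencil $\langle p,K\rangle$ onto itself and fixes every point of the generator $\overline{p}$, and suppose that (i) $\Delta$ is transitive on $\mathcal{P}\setminus\overline{p}$; (ii) for every $r\in K\setminus\{p\}$ and all $x,y\in K\setminus\{p,r\}$ there is $\sigma\in\Delta_r$ with $\sigma(x)=y$. Then the residual skewaffine plane $\mathbb{SA}(p,K)=(\mathcal{P}\setminus\overline{p},\sqcup,\parallel)$, i.e. the group space of $\Delta$ acting on $\mathcal{P}\setminus\overline{p}$, is a desarguesian skewaffine space.
   Context: A Laguerre plane is a structure $\mathbb{L}=(\mathcal{P},\mathcal{C},-)$ with a set $\mathcal{P}$ of points, a set $\mathcal{C}\subset 2^{\mathcal{P}}$ of circles and an equivalence relation $-$ on $\mathcal{P}$ (parallelity of points), whose classes are called generators; $\overline{p}$ is the generator containing $p$. Axioms: (1) three pairwise nonparallel points lie on a unique circle; (2) for every circle $K$ and nonparallel points $p\in K$, $q\notin K$ there is exactly one circle $L$ through $q$ with $K\cap L=\{p\}$; (3) for any point $p$ and circle $K$ there is exactly one point $q\in K$ with $p-q$; (4) some circle contains at least three points but not all points. Automorphisms are permutations of $\mathcal{P}$ mapping circles to circles and generators to generators. Two circles are tangent in $p$ if their intersection is $\{p\}$. For $p\in K$, $\langle p,K\rangle$ is the set consisting of $K$ and all circles tangent to $K$ in $p$. $\Delta_r$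 is the stabilizer of $r$ in $\Delta$. Group space: for a group $\mathbf{G}$ acting on a set $X$, put $x\sqcup y=\{x\}\cup\mathbf{G}_x y$ for $x\ne y$ in $X$; the sets $x\sqcup y$ are called lines, and lines $A,A'$ are parallel ($A\parallel A'$) if $gA=A'$ for some $g\in\mathbf{G}$. $\mathbb{SA}(p,K)$ is this structure for $\mathbf{G}=\Delta$, $X=\mathcal{P}\setminus\overline{p}$. A skewaffine space is a structure $(X,\sqcup,\parallel)$ with $X\neq\emptyset$, a function $\sqcup:\{(x,y)\in X^2: x\ne y\}\to 2^X$ (lines are the sets $x\sqcup y$) and an equivalence relation $\parallel$ on lines, such that: (L1) $x,y\in x\sqcup y$; (L2) $z\in (x\sqcup y)\setminus\{x\}$ implies $x\sqcup y=x\sqcup z$; (P1) for any line $A$ and point $x$ there is exactly one line of the form $x\sqcup y$ parallel to $A$; (P2) for all $x\neq y$, $x'\ne y'$: $x\sqcup y\parallel x'\sqcup y'$ implies $y\sqcup x\parallel y'\sqcup x'$; (T) if $x,y,z$ are pairwise different and $x\sqcup y\parallel x'\sqcup y'$, there is a point $z'$ with $x\sqcup z\parallel x'\sqcup z'$ and $y\sqcup z\parallel y'\sqcup z'$. It is desarguesian if moreover: (Des) for all pairwise different $u,x,y,z\in X$ and every $x'\in (u\sqcup x)\setminus\{u\}$ there are $y'\in (u\sqcup y)\setminus\{u\}$ and $z'\in (u\sqcup z)\setminus\{u\}$ with $x\sqcup y\parallel x'\sqcup y'$, $x\sqcup z\parallel x'\sqcup z'$, $y\sqcup z\parallel y'\sqcup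 z'$.
   Formalization: The formal theorem adds that circles do not have exactly four points (the plane is not of order 3); in order 3 the claim fails, since a two-point line inside a generator is a join from both its points and the uniqueness in (P1) breaks. *)

theory Defs
  imports "HOL-Algebra.Group_Action"
begin

section \<open>Laguerre planes\<close>

locale laguerre_plane =
  fixes P :: "'a set" and C :: "'a set set" and par :: "'a rel"
  assumes circles_subset: "C \<subseteq> Pow P"
    and par_equiv: "equiv P par"
    and three_points:
      "\<lbrakk>x \<in> P; y \<in> P; z \<in> P; (x, y) \<notin> par; (x, z) \<notin> par; (y, z) \<notin> par\<rbrakk>
        \<Longrightarrow> \<exists>!K. K \<in> C \<and> x \<in> K \<and> y \<in> K \<and> z \<in> K"
    and touching:
      "\<lbrakk>K \<in> C; p \<in> K; q \<in> P; q \<notin> K; (p, q) \<notin> par\<rbrakk>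
        \<Longrightarrow> \<exists>!L. L \<in> C \<and> q \<in> L \<and> K \<inter> L = {p}"
    and parallel_point:
      "\<lbrakk>p \<in> P; K \<in> C\<rbrakk> \<Longrightarrow> \<exists>!q. q \<in> K \<and> (p, q) \<in> par"
    and rich:
      "\<exists>K\<in>C. (\<exists>x\<in>K. \<exists>y\<in>K. \<exists>z\<in>K. x \<noteq> y \<and> x \<noteq> z \<and> y \<noteq> z) \<and> K \<noteq> P"

definition generator :: "'a rel \<Rightarrow> 'a \<Rightarrow> 'a set" where
  "generator par p = par `` {p}"

text \<open>The generators are the elements of the quotient \<open>P // par\<close>.\<close>

definition laguerre_automorphisms :: "'a set \<Rightarrow> 'a set set \<Rightarrow> 'a rel \<Rightarrow> ('a \<Rightarrow> 'a) set" where
  "laguerre_automorphisms P C par =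
    {\<sigma> \<in> Bij P. (\<forall>K\<in>C. \<sigma> ` K \<in> C) \<and> (\<forall>g \<in> P // par. \<sigma> ` g \<in> P // par)}"

definition pencil :: "'a set set \<Rightarrow> 'a \<Rightarrow> 'a set \<Rightarrow> 'a set set" where
  "pencil C p K = insert K {L \<in> C. K \<inter> L = {p}}"


section \<open>Skewaffine spaces\<close>

text \<open>The join \<open>J\<close> is only meaningful on pairs of distinct points of \<open>X\<close>. Hence every
  occurrence of \<open>J x y\<close> in the axioms below carries the guard \<open>x \<noteq> y\<close>,
  also where the point \<open>y\<close> is asserted to exist.\<close>

definition lines :: "'a set \<Rightarrow> ('a \<Rightarrow> 'a \<Rightarrow> 'a set) \<Rightarrow> 'a set set" where
  "lines X J = {J x y | x y. x \<in> X \<and> y \<in> X \<and> x \<noteq> y}"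

locale skewaffine_space =
  fixes X :: "'a set" and J :: "'a \<Rightarrow> 'a \<Rightarrow> 'a set" and R :: "'a set rel"
  assumes nonempty: "X \<noteq> {}"
    and join_subset: "\<lbrakk>x \<in> X; y \<in> X; x \<noteq> y\<rbrakk> \<Longrightarrow> J x y \<subseteq> X"
    and parallel_equiv: "equiv (lines X J) R"
    and L1: "\<lbrakk>x \<in> X; y \<in> X; x \<noteq> y\<rbrakk> \<Longrightarrow> x \<in> J x y \<and> y \<in> J x y"
    and L2: "\<lbrakk>x \<in> X; y \<in> X; x \<noteq> y; z \<in> J x y - {x}\<rbrakk> \<Longrightarrow> J x y = J x z"
    and P1: "\<lbrakk>A \<in> lines X J; x \<in> X\<rbrakk>
        \<Longrightarrow> \<exists>!B. (\<exists>y\<in>X. y \<noteq> x \<and> B = J x y) \<and> (B, A) \<in> R"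
    and P2: "\<lbrakk>x \<in> X; y \<in> X; x \<noteq> y; x' \<in> X; y' \<in> X; x' \<noteq> y'; (J x y, J x' y') \<in> R\<rbrakk>
        \<Longrightarrow> (J y x, J y' x') \<in> R"
    and T: "\<lbrakk>x \<in> X; y \<in> X; z \<in> X; x \<noteq> y; x \<noteq> z; y \<noteq> z; x' \<in> X; y' \<in> X; x' \<noteq> y';
          (J x y, J x' y') \<in> R\<rbrakk>
        \<Longrightarrow> \<exists>z'\<in>X. z' \<noteq> x' \<and> z' \<noteq> y' \<and> (J x z, J x' z') \<in> R \<and> (J y z, J y' z') \<in> R"

locale desarguesian_skewaffine_space = skewaffine_space +
  assumes Des: "\<lbrakk>u \<in> X; x \<in> X; y \<in> X; z \<in> X;
          u \<noteq> x; u \<noteq> y; u \<noteq> z; x \<noteq> y; x \<noteq> z; y \<noteq> z; x' \<in> J u x - {u}\<rbrakk>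
        \<Longrightarrow> \<exists>y' \<in> J u y - {u}. \<exists>z' \<in> J u z - {u}.
              x' \<noteq> y' \<and> x' \<noteq> z' \<and> y' \<noteq> z' \<and>
              (J x y, J x' y') \<in> R \<and> (J x z, J x' z') \<in> R \<and> (J y z, J y' z') \<in> R"


section \<open>Group spaces\<close>

definition group_space_join ::
    "('g, 'm) monoid_scheme \<Rightarrow> ('g \<Rightarrow> 'a \<Rightarrow> 'a) \<Rightarrow> 'a \<Rightarrow> 'a \<Rightarrow> 'a set" where
  "group_space_join G \<phi> x y = {x} \<union> orbit (G\<lparr>carrier := stabilizer G \<phi> x\<rparr>) \<phi> y"

definition group_space_parallel ::
    "('g, 'm) monoid_scheme \<Rightarrow> 'a set \<Rightarrow> ('g \<Rightarrow> 'a \<Rightarrow> 'a) \<Rightarrow> 'a set rel" where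
  "group_space_parallel G X \<phi> =
    {(A, A'). A \<in> lines X (group_space_join G \<phi>) \<and> A' \<in> lines X (group_space_join G \<phi>) \<and>
              (\<exists>g \<in> carrier G. \<phi> g ` A = A')}"


section \<open>The residual skewaffine plane\<close>

text \<open>The group space of \<open>\<Delta>\<close>, a subgroup of \<open>BijGroup P\<close> which fixes the generator of \<open>p\<close>,
  acting on the points outside that generator. Since members of \<open>Bij X\<close> are extensional,
  the action on \<open>X\<close> is given by restricting the permutations to \<open>X\<close>.

  In the order 3 plane (circles of four points), the lines \<open>{x, y}\<close> with \<open>x\<close> and \<open>y\<close> on one
  generator are joins both from \<open>x\<close> and from \<open>y\<close>, but no element of \<open>\<Delta>\<close> interchanges
  \<open>x\<close> and \<open>y\<close>. There the uniqueness in \<open>P1\<close> fails, as does \<open>T\<close>. No other order is affected.\<close>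

definition residual_points :: "'a set \<Rightarrow> 'a rel \<Rightarrow> 'a \<Rightarrow> 'a set" where
  "residual_points P par p = P - generator par p"

definition residual_action :: "'a set \<Rightarrow> 'a rel \<Rightarrow> 'a \<Rightarrow> ('a \<Rightarrow> 'a) \<Rightarrow> 'a \<Rightarrow> 'a" where
  "residual_action P par p \<sigma> = restrict \<sigma> (residual_points P par p)"

definition residual_join ::
    "'a set \<Rightarrow> 'a rel \<Rightarrow> 'a \<Rightarrow> ('a \<Rightarrow> 'a) set \<Rightarrow> 'a \<Rightarrow> 'a \<Rightarrow> 'a set" where
  "residual_join P par p \<Delta> =
    group_space_join (BijGroup P\<lparr>carrier := \<Delta>\<rparr>) (residual_action P par p)"

definition residual_parallel ::
    "'a set \<Rightarrow> 'a rel \<Rightarrow> 'a \<Rightarrow> ('a \<Rightarrow> 'a) set \<Rightarrow> 'a set rel" where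
  "residual_parallel P par p \<Delta> =
    group_space_parallel (BijGroup P\<lparr>carrier := \<Delta>\<rparr>) (residual_points P par p)
      (residual_action P par p)"

end

theory Submission
  imports Defs
begin

text \<open>The idea is that a group space is desarguesian for a formal reason, once parallelity of lines can be
  realised by group elements that respect base points. Say that \<open>x \<squnion> y\<close> and \<open>x' \<squnion> y'\<close> are parallel.
  If some \<open>g\<close> maps \<open>x\<close> to \<open>x'\<close> and \<open>y\<close> to \<open>y'\<close>, axiom \<open>T\<close> holds with \<open>z' = g z\<close>, and the
  other axioms are as direct; \<open>Des\<close> is witnessed by the images of \<open>y\<close> and \<open>z\<close> under an element of the
  stabilizer of \<open>u\<close> that takes \<open>x\<close> to \<open>x'\<close>. But parallelity is only given by some \<open>g\<close> that maps one set onto the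
  other. Such a \<open>g\<close> takes \<open>x\<close> to a base point of the second line, possibly one different from \<open>x'\<close>.
  So everything depends on the fact that any two base points of the same line are conjugate under the
  setwise stabilizer of that line.

  For lines with at least three points this conjugacy holds in every group space (lemma
  \<open>base_points_conjugate\<close>). What remains are two-point lines \<open>{x, y}\<close> for which both \<open>x\<close> and \<open>y\<close> are base
  points, and for these an element exchanging \<open>x\<close> and \<open>y\<close> is required
  (theorem \<open>desarguesian_group_space\<close>).

  In the residual space of a Laguerre plane, the line from \<open>x\<close> to a nonparallel point \<open>y\<close> consists of the
  residual points of the circle through \<open>y\<close> that touches, in \<open>x\<close>, the member of the pencil \<open>\<langle>p, K\<rangle>\<close>
  through \<open>x\<close> (lemma \<open>J_nonparallel\<close>): the stabilizer of \<open>x\<close> preserves this circle because it fixes the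
  point of the circle on the generator of \<open>p\<close>, and the transitivity
  assumed on \<open>K\<close> carries over to the other residual points of the circle. Such a line
  has two points only if circles have three points. A line from \<open>x\<close> to a parallel point \<open>y\<close> has more
  than two points whenever circles have at least five, since otherwise two circles would share three
  points (lemma \<open>parallel_point_not_fixed\<close>). With circles of four points excluded, two-point lines occur
  only in the plane of order two, where generators have two points as well and the required
  exchange can be read off (lemma \<open>mutual_base_points_swapped\<close>).\<close>

section \<open>Group spaces of transitive actions\<close>

context group_action
begin

lemma mem_group_space_join:
  "z \<in> group_space_join G \<phi> x y \<longleftrightarrow> z = x \<or> (\<exists>g\<in>carrier G. \<phi> g x = x \<and> \<phi> g y = z)"
  by (auto simp: group_space_join_def orbit_def stabilizer_def)

lemma group_acting: "group G"
  using group_hom group_hom.axioms(1) by auto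

lemma action_one: "x \<in> E \<Longrightarrow> \<phi> \<one> x = x"
  using id_eq_one by (metis restrict_apply')

lemma action_inv: "\<lbrakk>g \<in> carrier G; x \<in> E\<rbrakk> \<Longrightarrow> \<phi> (inv g) (\<phi> g x) = x"
  using orbit_sym_aux by blast

lemma action_inv': "\<lbrakk>g \<in> carrier G; x \<in> E\<rbrakk> \<Longrightarrow> \<phi> g (\<phi> (inv g) x) = x"
  using action_inv[of "inv g" x] group.inv_closed[OF group_acting] group.inv_inv[OF group_acting]
  by auto

lemma action_closed: "\<lbrakk>g \<in> carrier G; x \<in> E\<rbrakk> \<Longrightarrow> \<phi> g x \<in> E"
  using element_image by blast

lemma action_eq_iff: "\<lbrakk>g \<in> carrier G; x \<in> E; y \<in> E\<rbrakk> \<Longrightarrow> \<phi> g x = \<phi> g y \<longleftrightarrow> x = y"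
  using inj_prop inj_on_eq_iff by metis

lemmas carrier_closed = group.inv_closed[OF group_acting] monoid.m_closed[OF group.is_monoid[OF group_acting]]
  monoid.one_closed[OF group.is_monoid[OF group_acting]]

lemma group_space_join_left: "x \<in> group_space_join G \<phi> x y"
  by (simp add: mem_group_space_join)

lemma group_space_join_right: "\<lbrakk>x \<in> E; y \<in> E\<rbrakk> \<Longrightarrow> y \<in> group_space_join G \<phi> x y"
  using action_one carrier_closed(3) by (auto simp: mem_group_space_join)

lemma group_space_join_subset:
  "\<lbrakk>x \<in> E; y \<in> E\<rbrakk> \<Longrightarrow> group_space_join G \<phi> x y \<subseteq> E"
  using action_closed by (auto simp: mem_group_space_join)

lemma action_image_join_subset:
  assumes g: "g \<in> carrier G" and x: "x \<in> E" and y: "y \<in> E"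
  shows "\<phi> g ` group_space_join G \<phi> x y \<subseteq> group_space_join G \<phi> (\<phi> g x) (\<phi> g y)"
proof
  fix z assume "z \<in> \<phi> g ` group_space_join G \<phi> x y"
  then consider "z = \<phi> g x" | h where "h \<in> carrier G" "\<phi> h x = x" "z = \<phi> g (\<phi> h y)"
    by (auto simp: mem_group_space_join)
  then show "z \<in> group_space_join G \<phi> (\<phi> g x) (\<phi> g y)"
  proof cases
    case 1 then show ?thesis by (simp add: mem_group_space_join)
  next
    case (2 h)
    \<comment> \<open>The conjugate of \<open>h\<close> stabilizes \<open>\<phi> g x\<close>.\<close>
    let ?k = "g \<otimes> (h \<otimes> inv g)"
    have *: "\<phi> ?k (\<phi> g w) = \<phi> g (\<phi> h w)" if "w \<in> E" for w
      using that g 2(1) by (simp add: composition_rule carrier_closed action_closed action_inv)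
    have "?k \<in> carrier G" using g 2(1) by (simp add: carrier_closed)
    then show ?thesis using *[OF x] *[OF y] 2 by (auto simp: mem_group_space_join)
  qed
qed

lemma action_image_join:
  assumes g: "g \<in> carrier G" and x: "x \<in> E" and y: "y \<in> E"
  shows "\<phi> g ` group_space_join G \<phi> x y = group_space_join G \<phi> (\<phi> g x) (\<phi> g y)"
proof (rule antisym[OF action_image_join_subset[OF assms]])
  let ?J = "group_space_join G \<phi>"
  have "\<phi> (inv g) ` ?J (\<phi> g x) (\<phi> g y) \<subseteq> ?J x y"
    using action_image_join_subset[of "inv g" "\<phi> g x" "\<phi> g y"] assms
    by (simp add: carrier_closed action_closed action_inv)
  then have "\<phi> g ` \<phi> (inv g) ` ?J (\<phi> g x) (\<phi> g y) \<subseteq> \<phi> g ` ?J x y"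
    by (rule image_mono)
  moreover have "\<phi> g ` \<phi> (inv g) ` S = S" if "S \<subseteq> E" for S
    using that g by (auto simp: image_image action_inv' subset_iff)
  ultimately show "?J (\<phi> g x) (\<phi> g y) \<subseteq> \<phi> g ` ?J x y"
    using group_space_join_subset assms by (simp add: action_closed)
qed

text \<open>A line with base point \<open>x\<close> consists of \<open>x\<close> and one orbit of the stabilizer
  of \<open>x\<close>, so any of its other points generates it.\<close>

lemma group_space_join_eq:
  assumes x: "x \<in> E" and y: "y \<in> E" and z: "z \<in> group_space_join G \<phi> x y" "z \<noteq> x"
  shows "group_space_join G \<phi> x y = group_space_join G \<phi> x z"
proof -
  obtain g where g: "g \<in> carrier G" "\<phi> g x = x" "\<phi> g y = z"
    using z by (auto simp: mem_group_space_join)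
  have gi: "inv g \<in> carrier G" "\<phi> (inv g) x = x" "\<phi> (inv g) z = y"
    using g x y action_inv carrier_closed(1) by force+
  have zE: "z \<in> E" using g y action_closed by blast
  have sub: "group_space_join G \<phi> x b \<subseteq> group_space_join G \<phi> x a"
    if "k \<in> carrier G" "\<phi> k x = x" "\<phi> k a = b" "a \<in> E" for a b k
    using that x by (auto simp: mem_group_space_join) (metis carrier_closed(2) composition_rule)
  show ?thesis
    using sub[OF g y] sub[OF gi zE] by blast
qed

lemma stabilizer_image_join:
  assumes "g \<in> carrier G" "x \<in> E" "y \<in> E" "\<phi> g x = x"
  shows "\<phi> g ` group_space_join G \<phi> x y = group_space_join G \<phi> x y"
proof (cases "x = y")
  case True then show ?thesis using assms by (simp add: action_image_join)
next
  case False
  then have "\<phi> g y \<noteq> x" using assms action_eq_iff by metis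
  moreover have "\<phi> g y \<in> group_space_join G \<phi> x y"
    using assms by (auto simp: mem_group_space_join)
  ultimately show ?thesis using assms group_space_join_eq[of x y] by (simp add: action_image_join)
qed

end

context transitive_action
begin

text \<open>A set \<open>S\<close> may be a line with respect to two different base points \<open>x\<close> and \<open>x'\<close>; then an
  element of the stabilizer of \<open>S\<close> should take one to the other. If \<open>S\<close> has a third point \<open>z\<close>, this
  is automatic: the stabilizers of \<open>x\<close> and of \<open>x'\<close> both preserve \<open>S\<close>, and while fixing \<open>x'\<close> one can
  move \<open>x\<close> to \<open>z\<close>, and while fixing \<open>x\<close> one can then move \<open>z\<close> to \<open>x'\<close>. Only two-point lines
  need the hypothesis.\<close>

lemma base_points_conjugate:
  assumes swap: "\<And>x y. \<lbrakk>x \<in> E; y \<in> E; x \<noteq> y; group_space_join G \<phi> x y = {x, y};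
      group_space_join G \<phi> y x = {x, y}\<rbrakk> \<Longrightarrow> \<exists>g\<in>carrier G. \<phi> g x = y \<and> \<phi> g y = x"
    and E: "x \<in> E" "y \<in> E" "x' \<in> E" "y' \<in> E" and ne: "x \<noteq> y" "x' \<noteq> y'"
    and eq: "group_space_join G \<phi> x y = group_space_join G \<phi> x' y'" (is "?S = ?S'")
  shows "\<exists>g\<in>carrier G. \<phi> g x = x' \<and> \<phi> g ` ?S = ?S"
proof (cases "x = x'")
  case True
  then show ?thesis
    using E action_one carrier_closed(3) stabilizer_image_join by metis
next
  case False
  have x'S: "x' \<in> ?S" and xS: "x \<in> ?S" and xS': "x \<in> ?S'"
    using eq group_space_join_left by auto
  have S: "?S = group_space_join G \<phi> x x'"
    using False by (intro group_space_join_eq[OF E(1,2) x'S]) simp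
  have S': "?S' = group_space_join G \<phi> x' x"
    by (intro group_space_join_eq[OF E(3,4) xS' False])
  show ?thesis
  proof (cases "?S = {x, x'}")
    case True
    then obtain g where "g \<in> carrier G" "\<phi> g x = x'" "\<phi> g x' = x"
      using swap[of x x'] E False S S' eq by metis
    then show ?thesis using True by auto
  next
    case third: False
    then obtain z where z: "z \<in> ?S" "z \<noteq> x" "z \<noteq> x'" using xS x'S by auto
    have zE: "z \<in> E" using z group_space_join_subset E by blast
    have "z \<in> group_space_join G \<phi> x' x" using z eq S' by simp
    then obtain g where g: "g \<in> carrier G" "\<phi> g x' = x'" "\<phi> g x = z"
      using z by (auto simp: mem_group_space_join)
    have "x' \<in> group_space_join G \<phi> x z"
      using group_space_join_eq[OF E(1,2) z(1,2)] x'S by simp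
    then obtain h where h: "h \<in> carrier G" "\<phi> h x = x" "\<phi> h z = x'"
      using False by (auto simp: mem_group_space_join)
    have gS: "\<phi> g ` ?S = ?S"
      using eq stabilizer_image_join[OF g(1) E(3,4) g(2)] by simp
    have hS: "\<phi> h ` ?S = ?S"
      using stabilizer_image_join[OF h(1) E(1,2) h(2)] by simp
    have "\<phi> (h \<otimes> g) ` ?S = \<phi> h ` \<phi> g ` ?S"
      unfolding image_image
      by (rule image_cong) (use g h group_space_join_subset[OF E(1,2)] in \<open>auto simp: composition_rule\<close>)
    then have "\<phi> (h \<otimes> g) x = x' \<and> \<phi> (h \<otimes> g) ` ?S = ?S"
      using g h E gS hS by (simp add: composition_rule)
    moreover have "h \<otimes> g \<in> carrier G" using g h carrier_closed(2) by simp
    ultimately show ?thesis by blast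
  qed
qed

text \<open>By conjugacy of base points, two lines \<open>x \<squnion> y\<close> and \<open>x' \<squnion> y'\<close> are parallel only if one group
  element takes the pair \<open>(x, y)\<close> to \<open>(x', y')\<close>. After that every axiom that asserts the existence of
  points is satisfied by the images of the given points under such an element.\<close>

theorem desarguesian_group_space:
  assumes nonempty: "E \<noteq> {}"
    and swap: "\<And>x y. \<lbrakk>x \<in> E; y \<in> E; x \<noteq> y; group_space_join G \<phi> x y = {x, y};
      group_space_join G \<phi> y x = {x, y}\<rbrakk> \<Longrightarrow> \<exists>g\<in>carrier G. \<phi> g x = y \<and> \<phi> g y = x"
  shows "desarguesian_skewaffine_space E (group_space_join G \<phi>) (group_space_parallel G E \<phi>)"
proof -
  let ?J = "group_space_join G \<phi>" and ?R = "group_space_parallel G E \<phi>"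
  have R_iff: "(A, B) \<in> ?R \<longleftrightarrow>
      A \<in> lines E ?J \<and> B \<in> lines E ?J \<and> (\<exists>g\<in>carrier G. \<phi> g ` A = B)" for A B
    by (simp add: group_space_parallel_def)
  have line_subset: "A \<subseteq> E" if "A \<in> lines E ?J" for A
    using that group_space_join_subset by (auto simp: lines_def)
  have parallelI: "(?J x y, ?J (\<phi> g x) (\<phi> g y)) \<in> ?R"
    if "g \<in> carrier G" "x \<in> E" "y \<in> E" "x \<noteq> y" for g x y
  proof -
    have "?J x y \<in> lines E ?J" using that by (auto simp: lines_def)
    moreover have "?J (\<phi> g x) (\<phi> g y) \<in> lines E ?J"
      using that action_closed action_eq_iff unfolding lines_def by blast
    ultimately show ?thesis
      using action_image_join[OF that(1-3)] that(1) by (auto simp: group_space_parallel_def)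
  qed
  have parallelD: "\<exists>g\<in>carrier G. \<phi> g x = x' \<and> \<phi> g y = y'"
    if E: "x \<in> E" "y \<in> E" "x' \<in> E" "y' \<in> E" and ne: "x \<noteq> y" "x' \<noteq> y'"
      and R: "(?J x y, ?J x' y') \<in> ?R" for x y x' y'
  proof -
    obtain g where g: "g \<in> carrier G" "\<phi> g ` ?J x y = ?J x' y'"
      using R by (auto simp: group_space_parallel_def)
    have gxy: "\<phi> g x \<in> E" "\<phi> g y \<in> E" "\<phi> g x \<noteq> \<phi> g y"
      using g E ne action_closed action_eq_iff by auto
    have eq: "?J (\<phi> g x) (\<phi> g y) = ?J x' y'" using g E action_image_join by simp
    obtain h where h: "h \<in> carrier G" "\<phi> h (\<phi> g x) = x'" "\<phi> h ` ?J x' y' = ?J x' y'"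
      using base_points_conjugate[OF swap gxy(1,2) E(3,4) gxy(3) ne(2) eq] unfolding eq by blast
    \<comment> \<open>Now the base points agree; an element of the stabilizer of \<open>x'\<close> corrects the second point.\<close>
    let ?y = "\<phi> h (\<phi> g y)"
    have "?y \<in> ?J x' y'"
      using h(3) group_space_join_right[OF gxy(1,2)] eq by blast
    moreover have "?y \<noteq> x'" using h gxy action_eq_iff by metis
    ultimately have "y' \<in> ?J x' ?y"
      using group_space_join_eq[OF E(3,4)] group_space_join_right[OF E(3,4)] by blast
    then obtain k where k: "k \<in> carrier G" "\<phi> k x' = x'" "\<phi> k ?y = y'"
      using ne by (auto simp: mem_group_space_join)
    have "\<phi> (k \<otimes> (h \<otimes> g)) x = x'" "\<phi> (k \<otimes> (h \<otimes> g)) y = y'"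
      using g h k E gxy by (simp_all add: composition_rule carrier_closed)
    then show ?thesis
      using g h k by (intro bexI[of _ "k \<otimes> (h \<otimes> g)"]) (simp_all add: carrier_closed)
  qed
  have "skewaffine_space E ?J ?R"
  proof
    show "E \<noteq> {}" by fact
  next
    fix x y assume "x \<in> E" "y \<in> E" "x \<noteq> y"
    then show "?J x y \<subseteq> E" and "x \<in> ?J x y \<and> y \<in> ?J x y"
      using group_space_join_subset group_space_join_left group_space_join_right by auto
  next
    show "equiv (lines E ?J) ?R"
    proof (rule equivI)
      show "?R \<subseteq> lines E ?J \<times> lines E ?J" by (auto simp: group_space_parallel_def)
      show "refl_on (lines E ?J) ?R"
      proof (rule refl_onI)
        fix A assume A: "A \<in> lines E ?J"
        have "\<phi> \<one> ` A = A"
          using action_one line_subset[OF A] by (intro image_cong[where g = "\<lambda>x. x", simplified]) auto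
        then show "(A, A) \<in> ?R" using A carrier_closed(3) by (auto simp: group_space_parallel_def)
      qed
      show "sym ?R"
      proof (rule symI)
        fix A B assume R: "(A, B) \<in> ?R"
        then obtain g where g: "g \<in> carrier G" "\<phi> g ` A = B" and A: "A \<in> lines E ?J"
          by (auto simp: group_space_parallel_def)
        have "\<phi> (inv g) ` B = A"
          using g line_subset[OF A] action_inv by (force simp: image_image)
        moreover have "inv g \<in> carrier G" using g carrier_closed(1) by simp
        ultimately show "(B, A) \<in> ?R" using R unfolding R_iff by blast
      qed
      show "trans ?R"
      proof (rule transI)
        fix A B D assume R: "(A, B) \<in> ?R" "(B, D) \<in> ?R"
        then obtain g h where gh: "g \<in> carrier G" "\<phi> g ` A = B" "h \<in> carrier G" "\<phi> h ` B = D"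
          and A: "A \<in> lines E ?J"
          by (auto simp: group_space_parallel_def)
        have "\<phi> (h \<otimes> g) ` A = \<phi> h ` \<phi> g ` A"
          unfolding image_image
          by (rule image_cong) (use gh line_subset[OF A] in \<open>auto simp: composition_rule\<close>)
        then have "\<phi> (h \<otimes> g) ` A = D" using gh by simp
        moreover have "h \<otimes> g \<in> carrier G" using gh carrier_closed by simp
        ultimately show "(A, D) \<in> ?R" using R unfolding R_iff by blast
      qed
    qed
  next
    fix x y z assume "x \<in> E" "y \<in> E" "x \<noteq> y" "z \<in> ?J x y - {x}"
    then show "?J x y = ?J x z" by (intro group_space_join_eq) auto
  next
    fix A x assume A: "A \<in> lines E ?J" and x: "x \<in> E"
    obtain a b where ab: "a \<in> E" "b \<in> E" "a \<noteq> b" "A = ?J a b"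
      using A by (auto simp: lines_def)
    obtain g where g: "g \<in> carrier G" "\<phi> g x = a" using unique_orbit x ab by blast
    obtain y where y: "y \<in> E" "\<phi> g y = b" using bij_prop1[OF g(1) ab(2)] by blast
    have xy: "x \<noteq> y" using g y ab by auto
    show "\<exists>!B. (\<exists>y\<in>E. y \<noteq> x \<and> B = ?J x y) \<and> (B, A) \<in> ?R"
    proof (rule ex1I)
      show "(\<exists>w\<in>E. w \<noteq> x \<and> ?J x y = ?J x w) \<and> (?J x y, A) \<in> ?R"
        using parallelI[OF g(1) x y(1) xy] g y xy ab by auto
    next
      fix B assume "(\<exists>y\<in>E. y \<noteq> x \<and> B = ?J x y) \<and> (B, A) \<in> ?R"
      then obtain w where w: "w \<in> E" "w \<noteq> x" "B = ?J x w" "(B, A) \<in> ?R" by blast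
      obtain h where h: "h \<in> carrier G" "\<phi> h x = a" "\<phi> h w = b"
        using parallelD[of x w a b] w x ab by auto
      have *: "inv g \<otimes> h \<in> carrier G" using g h carrier_closed by simp
      have "\<phi> (inv g \<otimes> h) x = x" "\<phi> (inv g \<otimes> h) w = y"
        using action_inv[OF g(1) x] action_inv[OF g(1) y(1)] g h x y w
        by (simp_all add: composition_rule carrier_closed)
      then have "y \<in> ?J x w" using * by (auto simp: mem_group_space_join)
      then show "B = ?J x y" using group_space_join_eq[OF x w(1)] xy w(3) by blast
    qed
  next
    fix x y x' y' assume A: "x \<in> E" "y \<in> E" "x \<noteq> y" "x' \<in> E" "y' \<in> E" "x' \<noteq> y'"
      "(?J x y, ?J x' y') \<in> ?R"
    then obtain g where "g \<in> carrier G" "\<phi> g x = x'" "\<phi> g y = y'"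
      using parallelD by blast
    then show "(?J y x, ?J y' x') \<in> ?R" using A parallelI[of g y x] by auto
  next
    fix x y z x' y'
    assume A: "x \<in> E" "y \<in> E" "z \<in> E" "x \<noteq> y" "x \<noteq> z" "y \<noteq> z" "x' \<in> E" "y' \<in> E" "x' \<noteq> y'"
      "(?J x y, ?J x' y') \<in> ?R"
    then obtain g where "g \<in> carrier G" "\<phi> g x = x'" "\<phi> g y = y'"
      using parallelD by blast
    then show "\<exists>z'\<in>E. z' \<noteq> x' \<and> z' \<noteq> y' \<and> (?J x z, ?J x' z') \<in> ?R \<and> (?J y z, ?J y' z') \<in> ?R"
      using A parallelI[of g x z] parallelI[of g y z] action_closed action_eq_iff
      by (intro bexI[of _ "\<phi> g z"]) auto
  qed
  moreover have "desarguesian_skewaffine_space_axioms E ?J ?R"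
  proof
    fix u x y z x'
    assume A: "u \<in> E" "x \<in> E" "y \<in> E" "z \<in> E"
      "u \<noteq> x" "u \<noteq> y" "u \<noteq> z" "x \<noteq> y" "x \<noteq> z" "y \<noteq> z" "x' \<in> ?J u x - {u}"
    then obtain g where g: "g \<in> carrier G" "\<phi> g u = u" "\<phi> g x = x'"
      by (auto simp: mem_group_space_join)
    have mem: "\<phi> g w \<in> ?J u w - {u}" if "w \<in> E" "u \<noteq> w" for w
      using that g A(1) action_eq_iff[of g u w] by (auto simp: mem_group_space_join)
    show "\<exists>y' \<in> ?J u y - {u}. \<exists>z' \<in> ?J u z - {u}. x' \<noteq> y' \<and> x' \<noteq> z' \<and> y' \<noteq> z' \<and>
        (?J x y, ?J x' y') \<in> ?R \<and> (?J x z, ?J x' z') \<in> ?R \<and> (?J y z, ?J y' z') \<in> ?R"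
      using A g mem[of y] mem[of z] parallelI[of g x y] parallelI[of g x z] parallelI[of g y z]
        action_eq_iff[of g]
      by (intro bexI[of _ "\<phi> g y"] bexI[of _ "\<phi> g z"]) auto
  qed
  ultimately show ?thesis by (rule desarguesian_skewaffine_space.intro)
qed

end

section \<open>Circles and generators of a Laguerre plane\<close>

context laguerre_plane
begin

lemma par_refl: "x \<in> P \<Longrightarrow> (x, x) \<in> par"
  using par_equiv by (auto simp: equiv_def refl_on_def)

lemma par_sym: "(x, y) \<in> par \<Longrightarrow> (y, x) \<in> par"
  using par_equiv by (auto simp: equiv_def sym_def)

lemma par_trans: "\<lbrakk>(x, y) \<in> par; (y, z) \<in> par\<rbrakk> \<Longrightarrow> (x, z) \<in> par"
  using par_equiv by (auto simp: equiv_def trans_def)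

lemma par_closed: "(x, y) \<in> par \<Longrightarrow> x \<in> P \<and> y \<in> P"
  using par_equiv by (auto simp: equiv_def)

lemma circle_closed: "\<lbrakk>M \<in> C; x \<in> M\<rbrakk> \<Longrightarrow> x \<in> P"
  using circles_subset by auto

lemma circle_par_eq: "\<lbrakk>M \<in> C; x \<in> M; y \<in> M; (x, y) \<in> par\<rbrakk> \<Longrightarrow> x = y"
  using parallel_point[of x M] circle_closed par_refl by blast

lemma circle_meets_generator:
  assumes "x \<in> P" "M \<in> C" obtains y where "y \<in> M" "(x, y) \<in> par"
  using parallel_point[OF assms] by blast

lemma circle_eqI:
  assumes "L \<in> C" "M \<in> C" "A \<subseteq> L \<inter> M" "card A = 3"
  shows "L = M"
proof -
  obtain x y z where A: "A = {x, y, z}" "x \<noteq> y" "y \<noteq> z" "x \<noteq> z"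
    using assms(4) by (auto simp: card_3_iff)
  have "(x, y) \<notin> par" "(x, z) \<notin> par" "(y, z) \<notin> par"
    using A assms circle_par_eq[of L] by blast+
  moreover have "x \<in> P" "y \<in> P" "z \<in> P" using A assms circle_closed[of L] by auto
  ultimately show ?thesis using three_points[of x y z] A assms by blast
qed

text \<open>Every circle is a transversal of the generators, so parallelity matches any two circles.\<close>

lemma circles_equipotent:
  assumes M: "M \<in> C" and N: "N \<in> C"
  shows "\<exists>f. bij_betw f M N"
proof -
  define f where "f x = (SOME y. y \<in> N \<and> (x, y) \<in> par)" for x
  have f: "f x \<in> N \<and> (x, f x) \<in> par" if "x \<in> M" for x
    unfolding f_def using parallel_point[OF circle_closed[OF M that] N] by (metis (mono_tags, lifting) someI_ex)
  have "inj_on f M"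
  proof (rule inj_onI)
    fix x y assume xy: "x \<in> M" "y \<in> M" "f x = f y"
    then have "(x, y) \<in> par" using f par_sym par_trans by metis
    then show "x = y" using circle_par_eq M xy by blast
  qed
  moreover have "f ` M = N"
  proof (intro antisym subsetI)
    fix y assume y: "y \<in> N"
    obtain x where x: "x \<in> M" "(y, x) \<in> par" using circle_meets_generator circle_closed M N y by metis
    then have "(f x, y) \<in> par" using f par_sym par_trans by metis
    then have "f x = y" using circle_par_eq N y f x by blast
    then show "y \<in> f ` M" using x by blast
  qed (use f in auto)
  ultimately show ?thesis unfolding bij_betw_def by blast
qed

lemma card_circle_eq: "\<lbrakk>M \<in> C; N \<in> C\<rbrakk> \<Longrightarrow> card M = card N"
  using circles_equipotent bij_betw_same_card by metis

lemma circle_three_points: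
  assumes M: "M \<in> C"
  shows "infinite M \<or> 3 \<le> card M"
proof -
  obtain N x y z where N: "N \<in> C" "{x, y, z} \<subseteq> N" "x \<noteq> y" "x \<noteq> z" "y \<noteq> z"
    using rich by auto
  obtain f where f: "bij_betw f M N" using circles_equipotent M N by blast
  have "3 \<le> card N" if "finite N" using card_mono[OF that N(2)] N by simp
  then show ?thesis using f by (metis bij_betw_finite bij_betw_same_card)
qed

lemma pencil_circle: "\<lbrakk>M \<in> C; x \<in> M; L \<in> pencil C x M\<rbrakk> \<Longrightarrow> L \<in> C \<and> x \<in> L"
  by (auto simp: pencil_def)

text \<open>Outside the generator of \<open>x\<close>, the circles of a pencil \<open>\<langle>x, M\<rangle>\<close> partition the points: a point
  of \<open>M\<close> determines \<open>M\<close> itself, and any other point falls under the touching axiom.\<close>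

lemma pencil_ex1:
  assumes M: "M \<in> C" "x \<in> M" and y: "y \<in> P" "(x, y) \<notin> par"
  shows "\<exists>!L. L \<in> pencil C x M \<and> y \<in> L"
proof (cases "y \<in> M")
  case True
  have "y \<noteq> x" using y par_refl by auto
  then show ?thesis using True by (intro ex1I[of _ M]) (auto simp: pencil_def)
next
  case False
  then show ?thesis using touching[OF M y(1) False y(2)] by (auto simp: pencil_def)
qed

lemma pencil_eqI:
  assumes "M \<in> C" "x \<in> M" "L \<in> pencil C x M" "L' \<in> pencil C x M" "y \<in> L" "y \<in> L'" "x \<noteq> y"
  shows "L = L'"
proof -
  have L: "L \<in> C" "x \<in> L" using pencil_circle[OF assms(1-3)] by auto
  have "y \<in> P" "(x, y) \<notin> par"
    using circle_closed[OF L(1) assms(5)] circle_par_eq[OF L assms(5)] assms(7) by auto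
  then show ?thesis using pencil_ex1[OF assms(1,2), of y] assms by blast
qed

text \<open>When there are only three generators, a circle through \<open>a \<in> M\<close> is tangent to \<open>M\<close> in \<open>a\<close> as soon as it
  avoids the other two points of \<open>M\<close>. So for \<open>M = {x, a, s}\<close> the circle \<open>L\<close> touching \<open>M\<close> in \<open>a\<close> and
  containing \<open>z\<close>, which meets the generator of \<open>s\<close> in a point \<open>w\<close> off \<open>M\<close>, coincides with the circle
  through \<open>a\<close>, \<open>w\<close> and \<open>z'\<close>. A circle has only one point on the generator of \<open>x\<close>, hence \<open>z = z'\<close>.\<close>

lemma generator_two_points:
  assumes M: "M \<in> C" "card M = 3" "x \<in> M"
    and z: "(x, z) \<in> par" "z \<noteq> x" and z': "(x, z') \<in> par" "z' \<noteq> x"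
  shows "z = z'"
proof -
  have "finite M" using M card.infinite by fastforce
  then have "card (M - {x}) = 2" using M by simp
  then obtain a s where as: "M - {x} = {a, s}" "a \<noteq> s" by (auto simp: card_2_iff)
  then have Meq: "M = {x, a, s}" and "a \<in> M" "s \<in> M" "a \<noteq> x" "s \<noteq> x" using M by auto
  have "z \<notin> M" "z' \<notin> M" using circle_par_eq M z z' by blast+
  have npar: "(x, a) \<notin> par" "(x, s) \<notin> par" "(a, s) \<notin> par"
    using circle_par_eq M \<open>a \<in> M\<close> \<open>s \<in> M\<close> \<open>a \<noteq> x\<close> \<open>s \<noteq> x\<close> as by blast+
  then have az: "(a, z) \<notin> par" and az': "(a, z') \<notin> par"
    using z z' par_sym par_trans by blast+
  obtain L where L: "L \<in> C" "z \<in> L" "M \<inter> L = {a}"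
    using touching[OF M(1) \<open>a \<in> M\<close> _ \<open>z \<notin> M\<close> az] par_closed z by blast
  obtain w where w: "w \<in> L" "(s, w) \<in> par"
    using circle_meets_generator L circle_closed M \<open>s \<in> M\<close> by metis
  have "w \<noteq> s" using L w \<open>s \<in> M\<close> \<open>a \<noteq> s\<close> by auto
  have wM: "w \<notin> M" using circle_par_eq[OF M(1) \<open>s \<in> M\<close> _ w(2)] \<open>w \<noteq> s\<close> by blast
  have aw: "(a, w) \<notin> par" using npar w par_sym par_trans by blast
  have "(w, z') \<notin> par" using npar w z' par_sym par_trans by meson
  then obtain L' where L': "L' \<in> C" "a \<in> L'" "w \<in> L'" "z' \<in> L'"
    using three_points[of a w z'] aw az' par_closed w z' circle_closed M \<open>a \<in> M\<close> by blast
  have "x \<notin> L'" using L' z' circle_par_eq by blast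
  moreover have "s \<notin> L'" using L' w \<open>w \<noteq> s\<close> circle_par_eq by blast
  ultimately have "M \<inter> L' = {a}" using Meq L' by blast
  then have "L = L'"
    using touching[OF M(1) \<open>a \<in> M\<close> _ wM aw] par_closed w L L' by blast
  then show ?thesis
    using circle_par_eq[OF L(1) L(2)] L' z z' par_sym par_trans by blast
qed

lemma automorphism_bij: "\<sigma> \<in> laguerre_automorphisms P C par \<Longrightarrow> bij_betw \<sigma> P P"
  by (auto simp: laguerre_automorphisms_def Bij_def)

lemma automorphism_circle: "\<lbrakk>\<sigma> \<in> laguerre_automorphisms P C par; M \<in> C\<rbrakk> \<Longrightarrow> \<sigma> ` M \<in> C"
  by (auto simp: laguerre_automorphisms_def)

lemma automorphism_par:
  assumes \<sigma>: "\<sigma> \<in> laguerre_automorphisms P C par" and xy: "(x, y) \<in> par"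
  shows "(\<sigma> x, \<sigma> y) \<in> par"
proof -
  have "par `` {x} \<in> P // par" using xy par_closed by (blast intro: quotientI)
  then have g: "\<sigma> ` (par `` {x}) \<in> P // par"
    using \<sigma> by (simp add: laguerre_automorphisms_def)
  have "\<sigma> x \<in> \<sigma> ` (par `` {x})" "\<sigma> y \<in> \<sigma> ` (par `` {x})"
    using xy par_refl par_closed by auto
  then show ?thesis using quotient_eq_iff[OF par_equiv g g] by blast
qed

lemma automorphism_pencil:
  assumes \<sigma>: "\<sigma> \<in> laguerre_automorphisms P C par"
    and M: "M \<in> C" "x \<in> M" and L: "L \<in> pencil C x M"
  shows "\<sigma> ` L \<in> pencil C (\<sigma> x) (\<sigma> ` M)"
proof (cases "L = M")
  case False
  then have L: "L \<in> C" "M \<inter> L = {x}" using L by (auto simp: pencil_def)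
  then have "\<sigma> ` M \<inter> \<sigma> ` L = {\<sigma> x}"
    using inj_on_image_Int[OF bij_betw_imp_inj_on[OF automorphism_bij[OF \<sigma>]], of M L]
      circles_subset M by auto
  then show ?thesis using L \<sigma> automorphism_circle by (auto simp: pencil_def)
qed (simp add: pencil_def)

end

section \<open>The residual group space\<close>

locale laguerre_residue = laguerre_plane P C par
  for P :: "'a set" and C :: "'a set set" and par :: "'a rel" +
  fixes p :: 'a and K :: "'a set" and \<Delta> :: "('a \<Rightarrow> 'a) set"
  assumes p: "p \<in> P" and K: "K \<in> C" "p \<in> K"
    and subgroup: "subgroup \<Delta> (BijGroup P)"
    and automorphisms: "\<Delta> \<subseteq> laguerre_automorphisms P C par"
    and pencil_invariant: "\<forall>\<sigma>\<in>\<Delta>. (`) \<sigma> ` pencil C p K = pencil C p K"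
    and generator_fixed: "\<forall>\<sigma>\<in>\<Delta>. \<forall>q\<in>generator par p. \<sigma> q = q"
    and transitive: "\<forall>x \<in> P - generator par p. \<forall>y \<in> P - generator par p. \<exists>\<sigma>\<in>\<Delta>. \<sigma> x = y"
    and stabilizer_transitive:
      "\<forall>r \<in> K - {p}. \<forall>x \<in> K - {p, r}. \<forall>y \<in> K - {p, r}. \<exists>\<sigma>\<in>\<Delta>. \<sigma> r = r \<and> \<sigma> x = y"
begin

abbreviation "X \<equiv> residual_points P par p"
abbreviation "J \<equiv> residual_join P par p \<Delta>"

lemma mem_X: "x \<in> X \<longleftrightarrow> x \<in> P \<and> (p, x) \<notin> par"
  by (auto simp: residual_points_def generator_def)

lemma par_fixed: "\<lbrakk>\<sigma> \<in> \<Delta>; (p, q) \<in> par\<rbrakk> \<Longrightarrow> \<sigma> q = q"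
  using generator_fixed by (auto simp: generator_def)

lemma \<Delta>_bij: "\<sigma> \<in> \<Delta> \<Longrightarrow> bij_betw \<sigma> X X"
proof -
  assume \<sigma>: "\<sigma> \<in> \<Delta>"
  have "bij_betw \<sigma> P P" using \<sigma> automorphisms automorphism_bij by auto
  moreover have "bij_betw \<sigma> (generator par p) (generator par p)"
    using par_fixed[OF \<sigma>] by (auto simp: bij_betw_def inj_on_def generator_def image_iff)
  moreover have "generator par p \<subseteq> P" using par_closed by (auto simp: generator_def)
  ultimately show ?thesis
    unfolding residual_points_def by (intro bij_betw_DiffI)
qed

lemma residual_action_eq: "x \<in> X \<Longrightarrow> residual_action P par p \<sigma> x = \<sigma> x"
  by (simp add: residual_action_def)

sublocale residual: transitive_action "BijGroup P\<lparr>carrier := \<Delta>\<rparr>" X "residual_action P par p"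
proof (intro transitive_action.intro group_action.intro transitive_action_axioms.intro)
  interpret D: group "BijGroup P\<lparr>carrier := \<Delta>\<rparr>"
    using subgroup.subgroup_is_group[OF subgroup group_BijGroup] .
  interpret B: group "BijGroup X" by (rule group_BijGroup)
  have \<Delta>_Bij: "\<sigma> \<in> Bij P" if "\<sigma> \<in> \<Delta>" for \<sigma>
    using that automorphisms by (auto simp: laguerre_automorphisms_def)
  have Bij_X: "residual_action P par p \<sigma> \<in> Bij X" if "\<sigma> \<in> \<Delta>" for \<sigma>
  proof -
    have "bij_betw (residual_action P par p \<sigma>) X X"
      using \<Delta>_bij[OF that] by (rule bij_betw_cong[THEN iffD1, rotated]) (simp add: residual_action_eq)
    then show ?thesis by (simp add: Bij_def residual_action_def)
  qed
  have closed: "\<sigma> x \<in> X" if "\<sigma> \<in> \<Delta>" "x \<in> X" for \<sigma> x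
    using \<Delta>_bij[OF that(1)] that(2) bij_betwE by blast
  show "group_hom (BijGroup P\<lparr>carrier := \<Delta>\<rparr>) (BijGroup X) (residual_action P par p)"
  proof
    show "residual_action P par p \<in> hom (BijGroup P\<lparr>carrier := \<Delta>\<rparr>) (BijGroup X)"
    proof (rule homI)
      fix \<sigma> assume "\<sigma> \<in> carrier (BijGroup P\<lparr>carrier := \<Delta>\<rparr>)"
      then show "residual_action P par p \<sigma> \<in> carrier (BijGroup X)"
        using Bij_X by (simp add: BijGroup_def)
    next
      fix \<sigma> \<tau> assume "\<sigma> \<in> carrier (BijGroup P\<lparr>carrier := \<Delta>\<rparr>)" "\<tau> \<in> carrier (BijGroup P\<lparr>carrier := \<Delta>\<rparr>)"
      then have \<Delta>: "\<sigma> \<in> \<Delta>" "\<tau> \<in> \<Delta>" by auto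
      have "residual_action P par p (compose P \<sigma> \<tau>) =
          compose X (residual_action P par p \<sigma>) (residual_action P par p \<tau>)"
        using closed[OF \<Delta>(2)] by (auto simp: residual_action_def compose_def fun_eq_iff mem_X)
      then show "residual_action P par p (\<sigma> \<otimes>\<^bsub>BijGroup P\<lparr>carrier := \<Delta>\<rparr>\<^esub> \<tau>) =
          residual_action P par p \<sigma> \<otimes>\<^bsub>BijGroup X\<^esub> residual_action P par p \<tau>"
        using \<Delta> \<Delta>_Bij Bij_X by (simp add: BijGroup_def)
    qed
  qed
  fix x y assume "x \<in> X" "y \<in> X"
  then show "\<exists>\<sigma>\<in>carrier (BijGroup P\<lparr>carrier := \<Delta>\<rparr>). residual_action P par p \<sigma> x = y"
    using transitive by (auto simp: residual_points_def residual_action_eq)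
qed

lemma \<Delta>_closed: "\<lbrakk>\<sigma> \<in> \<Delta>; x \<in> X\<rbrakk> \<Longrightarrow> \<sigma> x \<in> X"
  using \<Delta>_bij bij_betwE by blast

lemma mem_J: "y \<in> X \<Longrightarrow> x \<in> X \<Longrightarrow> z \<in> J x y \<longleftrightarrow> z = x \<or> (\<exists>\<sigma>\<in>\<Delta>. \<sigma> x = x \<and> \<sigma> y = z)"
  by (simp add: residual_join_def residual.mem_group_space_join residual_action_eq)

lemma K_residual_point: obtains r where "r \<in> K" "r \<in> X"
proof -
  have "\<not> K \<subseteq> {p}"
  proof
    assume "K \<subseteq> {p}"
    then have "finite K \<and> card K \<le> 1" using card_mono[of "{p}" K] finite_subset by fastforce
    then show False using circle_three_points[OF K(1)] by simp
  qed
  then obtain r where "r \<in> K" "r \<noteq> p" by blast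
  then have "(p, r) \<notin> par" "r \<in> P" using circle_par_eq[OF K(1)] K circle_closed by auto
  then show ?thesis using that \<open>r \<in> K\<close> by (simp add: mem_X)
qed

text \<open>The member of the pencil \<open>\<langle>p, K\<rangle>\<close> through \<open>x\<close>: in the affine plane derived at \<open>p\<close>, the line through
  \<open>x\<close> in the direction of \<open>K\<close>. It depends only on \<open>x\<close> and on data invariant under \<open>\<Delta>\<close>, so the stabilizer
  of \<open>x\<close> preserves it.\<close>

definition base_circle :: "'a \<Rightarrow> 'a set" where
  "base_circle x = (THE L. L \<in> pencil C p K \<and> x \<in> L)"

lemma base_circle: "x \<in> X \<Longrightarrow> base_circle x \<in> pencil C p K \<and> x \<in> base_circle x"
  unfolding base_circle_def by (rule theI'[OF pencil_ex1[OF K]]) (simp_all add: mem_X)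

lemma base_circle_eqI: "\<lbrakk>x \<in> X; L \<in> pencil C p K; x \<in> L\<rbrakk> \<Longrightarrow> base_circle x = L"
  unfolding base_circle_def using pencil_ex1[OF K, of x] by (intro the1_equality) (simp_all add: mem_X)

lemma base_circle_C: "x \<in> X \<Longrightarrow> base_circle x \<in> C" and base_circle_p: "x \<in> X \<Longrightarrow> p \<in> base_circle x"
  using pencil_circle[OF K, of "base_circle x"] base_circle[of x] by blast+

lemma base_circle_image:
  assumes "\<sigma> \<in> \<Delta>" "x \<in> X" shows "\<sigma> ` base_circle x = base_circle (\<sigma> x)"
proof (rule base_circle_eqI[symmetric])
  show "\<sigma> ` base_circle x \<in> pencil C p K"
    using pencil_invariant assms base_circle by blast
  show "\<sigma> x \<in> \<sigma> ` base_circle x" using base_circle assms by blast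
qed (rule \<Delta>_closed[OF assms])

lemma circle_X: "\<lbrakk>M \<in> C; q \<in> M; (p, q) \<in> par; x \<in> M; x \<noteq> q\<rbrakk> \<Longrightarrow> x \<in> X"
  unfolding mem_X using circle_par_eq[of M q x] circle_closed[of M x] par_trans[OF par_sym, of p q x]
  by blast

text \<open>The transitivity assumed on \<open>K\<close> is transported to every other point by conjugation, since \<open>\<Delta>\<close> is
  transitive on the residual points.\<close>

lemma base_circle_transitive:
  assumes x: "x \<in> X" and s: "s \<in> base_circle x - {p, x}" and t: "t \<in> base_circle x - {p, x}"
  shows "\<exists>\<sigma>\<in>\<Delta>. \<sigma> x = x \<and> \<sigma> s = t"
proof -
  let ?\<phi> = "residual_action P par p" and ?G = "BijGroup P\<lparr>carrier := \<Delta>\<rparr>"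
  obtain r where r: "r \<in> K" "r \<in> X" by (rule K_residual_point)
  have K_eq: "base_circle r = K" using r by (intro base_circle_eqI) (simp_all add: pencil_def)
  obtain h where h: "h \<in> \<Delta>" "h r = x"
    using transitive r x by (auto simp: residual_points_def)
  have "p \<noteq> r" using r p par_refl mem_X by auto
  have hp: "h p = p" using par_fixed h p par_refl by blast
  have "h ` K = base_circle x" using base_circle_image[OF h(1) r(2)] h K_eq by simp
  then obtain s0 t0 where st: "s0 \<in> K" "h s0 = s" "t0 \<in> K" "h t0 = t"
    using s t by (metis DiffD1 image_iff)
  have ne: "s0 \<in> K - {p, r}" "t0 \<in> K - {p, r}" using st s t h hp by auto
  then obtain \<sigma> where \<sigma>: "\<sigma> \<in> \<Delta>" "\<sigma> r = r" "\<sigma> s0 = t0"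
    using stabilizer_transitive r \<open>p \<noteq> r\<close> by blast
  have X: "s0 \<in> X" "t0 \<in> X" using circle_X[OF K(1,2)] ne p par_refl by auto
  let ?k = "h \<otimes>\<^bsub>?G\<^esub> (\<sigma> \<otimes>\<^bsub>?G\<^esub> inv\<^bsub>?G\<^esub> h)"
  have G: "h \<in> carrier ?G" "\<sigma> \<in> carrier ?G" using h \<sigma> by auto
  have k: "?k \<in> carrier ?G" using G by (intro residual.carrier_closed(1,2))
  have *: "?\<phi> ?k (?\<phi> h w) = ?\<phi> h (?\<phi> \<sigma> w)" if "w \<in> X" for w
    using that G
    by (simp only: residual.composition_rule residual.carrier_closed residual.action_closed residual.action_inv)
  have "s \<in> X" using X(1) st \<Delta>_closed[OF h(1)] by force
  then have "?k x = x" "?k s = t"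
    using *[OF r(2)] *[OF X(1)] h \<sigma> st X x r \<Delta>_closed[OF h(1)] by (simp_all add: residual_action_eq)
  then show ?thesis using k by auto
qed

text \<open>Each point \<open>q\<close> of the generator of \<open>p\<close> is fixed by \<open>\<Delta>\<close> and singles out one circle in the pencil
  \<open>\<langle>x, base_circle x\<rangle>\<close>. Thus \<open>q\<close> serves as a \<open>\<Delta>\<close>-invariant label of these circles, and \<open>\<sigma>\<close> maps the
  circle with label \<open>q\<close> at \<open>x\<close> to the circle with label \<open>q\<close> at \<open>\<sigma> x\<close>.\<close>

lemma tangent_image:
  assumes \<sigma>: "\<sigma> \<in> \<Delta>" and x: "x \<in> X" and L: "L \<in> pencil C x (base_circle x)"
    and L': "L' \<in> pencil C (\<sigma> x) (base_circle (\<sigma> x))"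
    and q: "q \<in> L" "q \<in> L'" "(p, q) \<in> par"
  shows "\<sigma> ` L = L'"
proof -
  have x': "\<sigma> x \<in> X" using \<Delta>_closed \<sigma> x by blast
  have "\<sigma> ` L \<in> pencil C (\<sigma> x) (base_circle (\<sigma> x))"
    using automorphism_pencil[OF _ base_circle_C[OF x] _ L, of \<sigma>] base_circle[OF x] \<sigma> automorphisms
      base_circle_image[OF \<sigma> x] by auto
  moreover have "q \<in> \<sigma> ` L" using par_fixed[OF \<sigma> q(3)] q(1) by force
  moreover have "\<sigma> x \<noteq> q" using x' q(3) unfolding mem_X by blast
  ultimately show ?thesis
    using pencil_eqI[OF base_circle_C[OF x'] _ _ L', of "\<sigma> ` L" q] base_circle[OF x'] q(2) by blast
qed

lemma tangent_closed:
  assumes "x \<in> X" "L \<in> pencil C x (base_circle x)" shows "L \<in> C" "x \<in> L"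
  using pencil_circle[OF base_circle_C[OF assms(1)] _ assms(2)] base_circle[OF assms(1)] by auto

text \<open>Membership of either \<open>p\<close> or \<open>y\<close> makes \<open>L\<close> equal to the base circle, which meets every other circle of
  the pencil in \<open>x\<close> only.\<close>

lemma p_mem_tangent_iff:
  assumes x: "x \<in> X" and L: "L \<in> pencil C x (base_circle x)" and y: "y \<in> L" "x \<noteq> y"
  shows "p \<in> L \<longleftrightarrow> y \<in> base_circle x"
proof -
  have B: "base_circle x \<in> C" "x \<in> base_circle x" "p \<in> base_circle x" "x \<noteq> p"
    using base_circle_C base_circle base_circle_p x p par_refl mem_X by auto
  have "L = base_circle x" if "z \<in> L" "z \<in> base_circle x" "x \<noteq> z" for z
    using pencil_eqI[OF B(1,2) L, of _ z] that by (auto simp: pencil_def)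
  then show ?thesis using B y by blast
qed

text \<open>The stabilizer of \<open>x\<close> preserves \<open>L\<close>, because it fixes the label of \<open>L\<close>. Its transitivity on the base
  circle means transitivity on the generators other than those of \<open>p\<close> and \<open>x\<close>, and a point of \<open>L\<close> is
  determined by its generator; so the orbit of \<open>y\<close> fills \<open>L\<close> up to the points on those two generators.\<close>

lemma J_nonparallel:
  assumes x: "x \<in> X" and y: "y \<in> X" and xy: "(x, y) \<notin> par"
    and L: "L \<in> pencil C x (base_circle x)" "y \<in> L"
  shows "J x y = L \<inter> X"
proof -
  have LC: "L \<in> C" "x \<in> L" using tangent_closed x L by auto
  obtain q where q: "q \<in> L" "(p, q) \<in> par" using circle_meets_generator p LC by metis
  have stab: "\<sigma> y \<in> L" if "\<sigma> \<in> \<Delta>" "\<sigma> x = x" for \<sigma>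
    using tangent_image[of \<sigma> x L L q] that x L q by auto
  show ?thesis
  proof (intro antisym subsetI)
    fix z assume "z \<in> J x y"
    then show "z \<in> L \<inter> X" using mem_J x y LC stab \<Delta>_closed by auto
  next
    fix z assume z: "z \<in> L \<inter> X"
    show "z \<in> J x y"
    proof (cases "z = x")
      case True then show ?thesis using mem_J x y by auto
    next
      case False
      have xz: "(x, z) \<notin> par" using z LC circle_par_eq False by blast
      have proj: "\<exists>s \<in> base_circle x - {p, x}. (w, s) \<in> par" if "w \<in> X" "(x, w) \<notin> par" for w
      proof -
        have "w \<in> P" "(w, p) \<notin> par" "(w, x) \<notin> par"
          using that par_sym[of w p] par_sym[of w x] by (auto simp: mem_X)
        moreover obtain s where "s \<in> base_circle x" "(w, s) \<in> par"
          using circle_meets_generator[OF \<open>w \<in> P\<close> base_circle_C[OF x]] .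
        ultimately show ?thesis by blast
      qed
      obtain s t where st: "s \<in> base_circle x - {p, x}" "(y, s) \<in> par"
          "t \<in> base_circle x - {p, x}" "(z, t) \<in> par"
        using proj[of y] proj[of z] y z xy xz by blast
      obtain \<sigma> where \<sigma>: "\<sigma> \<in> \<Delta>" "\<sigma> x = x" "\<sigma> s = t"
        using base_circle_transitive x st by blast
      have "(\<sigma> y, t) \<in> par" using automorphism_par[OF _ st(2)] \<sigma> automorphisms by auto
      then have "(\<sigma> y, z) \<in> par" using st par_sym par_trans by blast
      then have "\<sigma> y = z" using circle_par_eq LC stab \<sigma> z by blast
      then show ?thesis using mem_J x y \<sigma> by blast
    qed
  qed
qed

text \<open>Suppose the stabilizer of \<open>x\<close> fixes a parallel point \<open>y\<close>. The orbit of a point \<open>s\<close> of the base circle of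
  \<open>x\<close> then lies on the line from \<open>y\<close> to \<open>s\<close> and hence on a circle \<open>M\<close> through \<open>y\<close>. But that orbit has at
  least three points, so \<open>M\<close> would be the base circle of \<open>x\<close>, which already meets the generator of \<open>y\<close>
  in \<open>x\<close>.\<close>

lemma parallel_point_not_fixed:
  assumes K5: "infinite K \<or> 5 \<le> card K"
    and x: "x \<in> X" and y: "y \<in> X" and xy: "x \<noteq> y" "(x, y) \<in> par"
  shows "J x y \<noteq> {x, y}"
proof
  assume J: "J x y = {x, y}"
  let ?B = "base_circle x"
  have B: "?B \<in> C" "x \<in> ?B" using base_circle_C base_circle x by auto
  have "infinite ?B \<or> 5 \<le> card ?B"
    using K5 circles_equipotent[OF B(1) K(1)] by (metis bij_betw_finite bij_betw_same_card)
  then have "infinite (?B - {p, x}) \<or> 3 \<le> card (?B - {p, x})"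
  proof
    assume "5 \<le> card ?B"
    moreover have "card {p, x} \<le> 2" by (simp add: card_insert_if)
    moreover have "card ?B - card {p, x} \<le> card (?B - {p, x})"
      by (rule diff_card_le_card_Diff) simp
    ultimately show ?thesis by linarith
  qed simp
  then obtain A where A: "A \<subseteq> ?B - {p, x}" "card A = 3"
    by (metis infinite_arbitrarily_large obtain_subset_with_card_n)
  then obtain s where s: "s \<in> A" by fastforce
  have sX: "s \<in> X" using circle_X[OF B(1) base_circle_p[OF x]] p par_refl A s by blast
  have "(x, s) \<notin> par" using B A s circle_par_eq by blast
  then have ys: "(y, s) \<notin> par" using xy par_trans by blast
  have By: "base_circle y \<in> C" "y \<in> base_circle y" using base_circle_C base_circle y by auto
  obtain M where M: "M \<in> pencil C y (base_circle y)" "s \<in> M"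
    using pencil_ex1[OF By _ ys] sX mem_X by blast
  have "A \<subseteq> M"
  proof
    fix t assume t: "t \<in> A"
    obtain \<sigma> where \<sigma>: "\<sigma> \<in> \<Delta>" "\<sigma> x = x" "\<sigma> s = t"
      using base_circle_transitive x A s t by blast
    have "\<sigma> y \<noteq> x"
      using \<Delta>_bij[OF \<sigma>(1)] \<sigma>(2) x y xy by (metis bij_betw_imp_inj_on inj_on_eq_iff)
    moreover have "\<sigma> y \<in> J x y" using mem_J x y \<sigma> by blast
    ultimately have "\<sigma> y = y" using J by blast
    then have "t \<in> J y s" using mem_J sX y \<sigma> by blast
    then show "t \<in> M" using J_nonparallel[OF y sX ys M] by blast
  qed
  then have "M = ?B" using circle_eqI[OF _ B(1), of M A] A tangent_closed y M by blast
  then show False using circle_par_eq[OF B] xy tangent_closed[OF y M(1)] by blast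
qed

text \<open>The hypothesis of the theorem on group spaces. Any \<open>\<sigma>\<close> with \<open>\<sigma> x = y\<close> will do, because both cases force the
  plane to have order two, where generators are pairs: the case of parallel points by the previous lemma
  (circles of four points being excluded),
  the case of nonparallel points because the circle carrying the line then has three points.\<close>

lemma mutual_base_points_swapped:
  assumes K4: "card K \<noteq> 4"
    and x: "x \<in> X" and y: "y \<in> X" and xy: "x \<noteq> y"
    and J: "J x y = {x, y}" "J y x = {x, y}"
  shows "\<exists>\<sigma>\<in>\<Delta>. \<sigma> x = y \<and> \<sigma> y = x"
proof -
  obtain \<sigma> where \<sigma>: "\<sigma> \<in> \<Delta>" "\<sigma> x = y"
    using transitive x y by (auto simp: residual_points_def)
  have \<sigma>y: "\<sigma> y \<noteq> y"
    using \<Delta>_bij[OF \<sigma>(1)] \<sigma>(2) x y xy by (metis bij_betw_imp_inj_on inj_on_eq_iff)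
  have By: "base_circle y \<in> C" "y \<in> base_circle y" using base_circle_C base_circle y by auto
  have "\<sigma> y = x"
  proof (cases "(x, y) \<in> par")
    case True
    have "card K = 3"
      using parallel_point_not_fixed[OF _ x y xy True] J K4 circle_three_points[OF K(1)] by linarith
    then have "card (base_circle y) = 3" using card_circle_eq[OF By(1) K(1)] by simp
    moreover have "(y, \<sigma> y) \<in> par" "(y, x) \<in> par"
      using automorphism_par[OF _ True] automorphisms \<sigma> par_sym True by auto
    ultimately show ?thesis using generator_two_points[OF By(1) _ By(2)] \<sigma>y xy by blast
  next
    case False
    then have yx: "(y, x) \<notin> par" using par_sym by blast
    have Bx: "base_circle x \<in> C" "x \<in> base_circle x" using base_circle_C base_circle x by auto
    obtain L where L: "L \<in> pencil C x (base_circle x)" "y \<in> L"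
      using pencil_ex1[OF Bx _ False] y mem_X by blast
    obtain L' where L': "L' \<in> pencil C y (base_circle y)" "x \<in> L'"
      using pencil_ex1[OF By _ yx] x mem_X by blast
    have LC: "L \<in> C" "x \<in> L" "L' \<in> C" "y \<in> L'" using tangent_closed x y L L' by auto
    obtain q q' where q: "q \<in> L" "(p, q) \<in> par" "q' \<in> L'" "(p, q') \<in> par"
      using circle_meets_generator p LC by metis
    have qX: "q \<noteq> x" "q \<noteq> y" using q x y mem_X by auto
    have LX: "L \<inter> X = {x, y}" using J_nonparallel x y False L J by blast
    then have "L = {x, y, q}"
      using circle_X[OF LC(1) q(1,2)] L LC q by blast
    then have "card L = 3" using xy qX by auto
    then have B3: "card (base_circle x) = 3" using card_circle_eq[OF Bx(1) LC(1)] by simp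
    \<comment> \<open>The labels \<open>q\<close> and \<open>q'\<close> are both \<open>p\<close> or both the other point of the generator of \<open>p\<close>.\<close>
    have "x \<in> base_circle y \<longleftrightarrow> y \<in> base_circle x"
      using base_circle_eqI base_circle x y by metis
    then have "p \<in> L \<longleftrightarrow> p \<in> L'"
      using p_mem_tangent_iff[OF x L xy] p_mem_tangent_iff[OF y L'] xy by blast
    then have "q = p \<longleftrightarrow> q' = p"
      using q circle_par_eq[OF LC(1) _ q(1)] circle_par_eq[OF LC(3) _ q(3)] by blast
    then have qq': "q = q'"
      using generator_two_points[OF Bx(1) B3 base_circle_p[OF x] q(2) _ q(4)] by blast
    \<comment> \<open>Hence \<open>\<sigma>\<close> preserves \<open>L = L'\<close>, whose only residual points are \<open>x\<close> and \<open>y\<close>.\<close>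
    have "\<sigma> ` L = L'" using tangent_image[OF \<sigma>(1) x L(1), of L' q] \<sigma> L' q qq' by blast
    moreover have "L = L'"
      using circle_eqI[OF LC(1,3), of "{x, y, q}"] L L' LC q qq' xy qX by auto
    ultimately have "\<sigma> y \<in> L \<inter> X" using L \<Delta>_closed \<sigma> y by blast
    then show ?thesis using LX \<sigma>y by blast
  qed
  then show ?thesis using \<sigma> by blast
qed

theorem residual_space_desarguesian:
  assumes "card K \<noteq> 4"
  shows "desarguesian_skewaffine_space X J (residual_parallel P par p \<Delta>)"
  unfolding residual_join_def residual_parallel_def
proof (rule residual.desarguesian_group_space)
  show "X \<noteq> {}" using K_residual_point by blast
next
  fix x y
  let ?J = "group_space_join (BijGroup P\<lparr>carrier := \<Delta>\<rparr>) (residual_action P par p)"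
  assume "x \<in> X" "y \<in> X" "x \<noteq> y" "?J x y = {x, y}" "?J y x = {x, y}"
  then show "\<exists>\<sigma>\<in>carrier (BijGroup P\<lparr>carrier := \<Delta>\<rparr>).
      residual_action P par p \<sigma> x = y \<and> residual_action P par p \<sigma> y = x"
    using mutual_base_points_swapped[OF assms, of x y] by (simp add: residual_join_def residual_action_eq)
qed

end

theorem theorem2p1:
  fixes P :: "'a set" and C :: "'a set set" and par :: "'a rel"
    and p :: 'a and K :: "'a set" and \<Delta> :: "('a \<Rightarrow> 'a) set"
  assumes "laguerre_plane P C par"
    and "p \<in> P" and "K \<in> C" and "p \<in> K"
    and "card K \<noteq> 4"
    and "subgroup \<Delta> (BijGroup P)"
    and "\<Delta> \<subseteq> laguerre_automorphisms P C par"
    and "\<forall>\<sigma>\<in>\<Delta>. (`) \<sigma> ` pencil C p K = pencil C p K"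
    and "\<forall>\<sigma>\<in>\<Delta>. \<forall>q\<in>generator par p. \<sigma> q = q"
    and "\<forall>x \<in> P - generator par p. \<forall>y \<in> P - generator par p. \<exists>\<sigma>\<in>\<Delta>. \<sigma> x = y"
    and "\<forall>r \<in> K - {p}. \<forall>x \<in> K - {p, r}. \<forall>y \<in> K - {p, r}. \<exists>\<sigma>\<in>\<Delta>. \<sigma> r = r \<and> \<sigma> x = y"
  shows "desarguesian_skewaffine_space (residual_points P par p)
           (residual_join P par p \<Delta>) (residual_parallel P par p \<Delta>)"
proof -
  interpret laguerre_residue P C par p K \<Delta>
    using assms by (intro laguerre_residue.intro laguerre_residue_axioms.intro)
  show ?thesis by (rule residual_space_desarguesian) fact
qed

end
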